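(* Assume that a fuzzy function $\tilde{f}: F(\mathbb{R}) \to F(\mathbb{R})$ is differentiable at $\tilde{x}$. Then, for any $k \in \mathbb{R}$, $k \odot \tilde{f}$ is also differentiable at $\tilde{x}$ and $(k \odot \tilde{f})^{\prime}(\tilde{x}) = k \odot \tilde{f}^{\prime}(\tilde{x})$.
   Context: Fuzzy numbers. A fuzzy number is a map $\tilde{a}:\mathbb{R}\to[0,1]$ such that: (i) $\tilde a(r_0)=1$ for some $r_0$; (ii) $\tilde a(\beta r+(1-\beta)t)\ge\min\{\tilde a(r),\tilde a(t)\}$ for all $r,t\in\mathbb{R}$, $\beta\in[0,1]$; (iii) $\tilde a$ is upper semicontinuous; (iv) the closure of $\{r:\tilde a(r)>0\}$ is compact. $F(\mathbb{R})$ is the set of all fuzzy numbers. For $\alpha\in(0,1]$ the $\alpha$-level set is $\tilde a_\alpha=\{r:\tilde a(r)\ge\alpha\}$, and $\tilde a_0$ is the closure of $\{r:\tilde a(r)>0\}$; these are compact intervals, written $\tilde a_\alpha=[\tilde a]_\alpha=[a_1(\alpha),a_2(\alpha)]$. A fuzzy number is determined by its level sets: $\tilde a=\bigcup_{\alpha\in[0,1]}\alpha\cdot\tilde a_\alpha$ (standard fuzzy union). Scalar multiplication, for real $\lambda$ and all $\alpha\in[0,1]$: $(\lambda\odot\tilde a)_\alpha=[\lambda a_1(\alpha),\lambda a_2(\alpha)]$ if $\lambda\ge0$ and $(\lambda\odot\tilde a)_\alpha=[\lambda a_2(\alpha),\lambda a_1(\alpha)]$ if $\lambda<0$. For a fuzzy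 function, $(k\odot\tilde f)(\tilde x)=k\odot\tilde f(\tilde x)$. Fuzzy functions. A function $\tilde f:F(\mathbb{R})\to F(\mathbb{R})$ is called a fuzzy function. The fuzzy variable $\tilde x$ is a fuzzification of a crisp real variable $x$: to each $x\in\mathbb{R}$ corresponds a fuzzy number $\tilde x$ (any LR-fuzzy number) with $\alpha$-level set $[x_1(x,\alpha),x_2(x,\alpha)]$. Here an LR-fuzzy number has membership function equal to $L((t-(a^L-l))/l)$ on $[a^L-l,a^L]$, to $1$ on $[a^L,a^U]$, and to $R(((a^U+r)-t)/r)$ on $[a^U,a^U+r]$, where $L,R:[0,1]\to[0,1]$ are non-decreasing with $L(0)=R(0)=0$, $L(1)=R(1)=1$. The $\alpha$-level set of $\tilde f(\tilde x)$ is $[f_1(x,\alpha),f_2(x,\alpha)]$, where $f_1,f_2$ (the $\alpha$-level functions of $\tilde f$) are composite functions: $f_i(x,\alpha)=f_i(x_1,x_2,\alpha)$ with $x_1=x_1(x,\alpha)$, $x_2=x_2(x,\alpha)$, $i=1,2$. Differentiability. $\tilde f$ is differentiable (at $\tilde x$, the fuzzy number corresponding to $x$) if: (i) $x_1(x,\alpha)$ and $x_2(x,\alpha)$ are differentiable with respect to $x$ for $\alpha\in[0,1]$; (ii) $f_1(x_1,x_2,\alpha)$ and $f_2(x_1,x_2,\alpha)$ are differentiable for each $\alpha\in[0,1]$, in which case one denotes $$f_i^{\prime}(x_1,x_2,\alpha)=\frac{\partial f_i}{\partial x_1}\frac{dx_1}{dx}+\frac{\partial f_i}{\partial x_2}\frac{dx_2}{dx},\quad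 i=1,2;$$ (iii) the union $\bigcup_{\alpha\in[0,1]}\alpha\,[\min\{f_1^{\prime},f_2^{\prime}\},\max\{f_1^{\prime},f_2^{\prime}\}]$ (with $f_i^{\prime}=f_i^{\prime}(x_1,x_2,\alpha)$) constitutes a fuzzy number. This fuzzy number is the derivative $\tilde f^{\prime}(\tilde x)$, with $$[\tilde f^{\prime}(\tilde x)]_\alpha=[\min\{f_1^{\prime}(x_1,x_2,\alpha),f_2^{\prime}(x_1,x_2,\alpha)\},\ \max\{f_1^{\prime}(x_1,x_2,\alpha),f_2^{\prime}(x_1,x_2,\alpha)\}],\quad\alpha\in[0,1].$$ *)

theory Defs
  imports "HOL-Analysis.Analysis"
begin

section \<open>Fuzzy numbers\<close>

definition usc :: "(real \<Rightarrow> real) \<Rightarrow> bool" where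
  "usc a \<longleftrightarrow> (\<forall>r c. a r < c \<longrightarrow> (\<forall>\<^sub>F t in nhds r. a t < c))"

definition is_fuzzy_number :: "(real \<Rightarrow> real) \<Rightarrow> bool" where
  "is_fuzzy_number a \<longleftrightarrow>
     (\<forall>r. 0 \<le> a r \<and> a r \<le> 1) \<and>
     (\<exists>r0. a r0 = 1) \<and>
     (\<forall>r t \<beta>. 0 \<le> \<beta> \<and> \<beta> \<le> 1 \<longrightarrow> min (a r) (a t) \<le> a (\<beta> * r + (1 - \<beta>) * t)) \<and>
     usc a \<and>
     compact (closure {r. 0 < a r})"

lemma is_fuzzy_number_zero: "is_fuzzy_number (indicator {0})"
proof -
  have "\<forall>\<^sub>F t in nhds r. indicator {0} t < c" if "indicator {0} r < c" for r c :: real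
  proof (cases "r = 0")
    case True
    then show ?thesis
      using that by (intro always_eventually) (auto simp: indicator_def)
  next
    case False
    then have "\<forall>\<^sub>F t in nhds r. t \<noteq> 0"
      by (intro t1_space_nhds)
    then show ?thesis
      by (rule eventually_mono) (use that False in \<open>auto simp: indicator_def\<close>)
  qed
  moreover have "{r. 0 < (indicator {0} r :: real)} = {0::real}"
    by (auto simp: indicator_def)
  ultimately show ?thesis
    unfolding is_fuzzy_number_def usc_def by (auto simp: indicator_def)
qed

typedef fuzzy = "{a. is_fuzzy_number a}"
  morphisms membership Abs_fuzzy
  using is_fuzzy_number_zero by blast

definition level :: "fuzzy \<Rightarrow> real \<Rightarrow> real set" where
  "level a \<alpha> = (if \<alpha> = 0 then closure {r. 0 < membership a r} else {r. \<alpha> \<le> membership a r})"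

text \<open>The end points \<open>a\<^sub>1(\<alpha>)\<close> and \<open>a\<^sub>2(\<alpha>)\<close> of the \<open>\<alpha>\<close>-level set; see \<open>level_eq_interval\<close> below.\<close>

definition lower :: "fuzzy \<Rightarrow> real \<Rightarrow> real" where
  "lower a \<alpha> = Inf (level a \<alpha>)"

definition upper :: "fuzzy \<Rightarrow> real \<Rightarrow> real" where
  "upper a \<alpha> = Sup (level a \<alpha>)"

text \<open>The standard fuzzy union \<open>\<Union>\<^bsub>\<alpha>\<in>[0,1]\<^esub> \<alpha> \<cdot> I\<^sub>\<alpha>\<close>, where \<open>\<alpha> \<cdot> I\<^sub>\<alpha>\<close> has membership
  degree \<open>\<alpha>\<close> on \<open>I\<^sub>\<alpha>\<close> and \<open>0\<close> elsewhere.\<close>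

definition fuzzy_union :: "(real \<Rightarrow> real set) \<Rightarrow> real \<Rightarrow> real" where
  "fuzzy_union I t = (SUP \<alpha>\<in>{0..1}. \<alpha> * indicator (I \<alpha>) t)"

text \<open>The product is specified by its level sets; existence and uniqueness are
  \<open>level_fuzzy_scale\<close> and \<open>fuzzy_eqI\<close> below.\<close>

definition fuzzy_scale :: "real \<Rightarrow> fuzzy \<Rightarrow> fuzzy"  (infixr "\<odot>" 75) where
  "k \<odot> a = (THE b. \<forall>\<alpha>\<in>{0..1}. level b \<alpha> =
     (if 0 \<le> k then {k * lower a \<alpha>..k * upper a \<alpha>} else {k * upper a \<alpha>..k * lower a \<alpha>}))"

section \<open>Differentiability of fuzzy functions\<close>

text \<open>The shape functions are only relevant on \<open>[0,1]\<close>. The spreads \<open>l\<close> and \<open>r\<close> are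
  positive since the membership function divides by them.\<close>

definition LR_fuzzy :: "fuzzy \<Rightarrow> bool" where
  "LR_fuzzy a \<longleftrightarrow> (\<exists>L R aL aU l r.
     L ` {0..1} \<subseteq> {0..1} \<and> mono_on {0..1} L \<and> L 0 = 0 \<and> L 1 = 1 \<and>
     R ` {0..1} \<subseteq> {0..1} \<and> mono_on {0..1} R \<and> R 0 = 0 \<and> R 1 = 1 \<and>
     aL \<le> aU \<and> 0 < l \<and> 0 < r \<and>
     (\<forall>t\<in>{aL - l..aL}. membership a t = L ((t - (aL - l)) / l)) \<and>
     (\<forall>t\<in>{aL..aU}. membership a t = 1) \<and>
     (\<forall>t\<in>{aU..aU + r}. membership a t = R ((aU + r - t) / r)) \<and>
     (\<forall>t. t < aL - l \<or> aU + r < t \<longrightarrow> membership a t = (0::real)))"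

text \<open>A fuzzification \<open>X\<close> sends each crisp \<open>x\<close> to the fuzzy number written \<open>x\<close> with a tilde.\<close>

definition fuzzification :: "(real \<Rightarrow> fuzzy) \<Rightarrow> bool" where
  "fuzzification X \<longleftrightarrow> (\<forall>x. LR_fuzzy (X x))"

text \<open>Level functions \<open>f\<^sub>i(x\<^sub>1, x\<^sub>2, \<alpha>)\<close> of a fuzzy function \<open>F\<close> along the fuzzification \<open>X\<close>.\<close>

definition level_functions ::
  "(real \<Rightarrow> fuzzy) \<Rightarrow> (fuzzy \<Rightarrow> fuzzy) \<Rightarrow> (real \<Rightarrow> real \<Rightarrow> real \<Rightarrow> real) \<Rightarrow>
   (real \<Rightarrow> real \<Rightarrow> real \<Rightarrow> real) \<Rightarrow> bool" where
  "level_functions X F f1 f2 \<longleftrightarrow> (\<forall>x. \<forall>\<alpha>\<in>{0..1}.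
     level (F (X x)) \<alpha> =
       {f1 (lower (X x) \<alpha>) (upper (X x) \<alpha>) \<alpha>..f2 (lower (X x) \<alpha>) (upper (X x) \<alpha>) \<alpha>})"

definition level_deriv ::
  "(real \<Rightarrow> fuzzy) \<Rightarrow> (real \<Rightarrow> real \<Rightarrow> real \<Rightarrow> real) \<Rightarrow> real \<Rightarrow> real \<Rightarrow> real" where
  "level_deriv X f x \<alpha> =
     deriv (\<lambda>u. f u (upper (X x) \<alpha>) \<alpha>) (lower (X x) \<alpha>) * deriv (\<lambda>y. lower (X y) \<alpha>) x +
     deriv (\<lambda>v. f (lower (X x) \<alpha>) v \<alpha>) (upper (X x) \<alpha>) * deriv (\<lambda>y. upper (X y) \<alpha>) x"

definition deriv_interval ::
  "(real \<Rightarrow> fuzzy) \<Rightarrow> (real \<Rightarrow> real \<Rightarrow> real \<Rightarrow> real) \<Rightarrow> (real \<Rightarrow> real \<Rightarrow> real \<Rightarrow> real) \<Rightarrow>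
   real \<Rightarrow> real \<Rightarrow> real set" where
  "deriv_interval X f1 f2 x \<alpha> =
     {min (level_deriv X f1 x \<alpha>) (level_deriv X f2 x \<alpha>)..
      max (level_deriv X f1 x \<alpha>) (level_deriv X f2 x \<alpha>)}"

text \<open>\<open>D\<close> is the derivative of \<open>F\<close> at \<open>X x\<close>. The union of the intervals is required to be a fuzzy
  number (it is \<open>membership D\<close>), and the intervals are required to be the level sets of that fuzzy
  number. The choice of level functions does not affect \<open>D\<close>; see \<open>has_fuzzy_deriv_unique\<close>.\<close>

definition has_fuzzy_deriv ::
  "(real \<Rightarrow> fuzzy) \<Rightarrow> (fuzzy \<Rightarrow> fuzzy) \<Rightarrow> real \<Rightarrow> fuzzy \<Rightarrow> bool" where
  "has_fuzzy_deriv X F x D \<longleftrightarrow> (\<exists>f1 f2. level_functions X F f1 f2 \<and>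
     (\<forall>\<alpha>\<in>{0..1}.
        (\<lambda>y. lower (X y) \<alpha>) differentiable (at x) \<and>
        (\<lambda>y. upper (X y) \<alpha>) differentiable (at x)) \<and>
     (\<forall>\<alpha>\<in>{0..1}.
        (\<lambda>(u, v). f1 u v \<alpha>) differentiable (at (lower (X x) \<alpha>, upper (X x) \<alpha>)) \<and>
        (\<lambda>(u, v). f2 u v \<alpha>) differentiable (at (lower (X x) \<alpha>, upper (X x) \<alpha>))) \<and>
     membership D = fuzzy_union (deriv_interval X f1 f2 x) \<and>
     (\<forall>\<alpha>\<in>{0..1}. level D \<alpha> = deriv_interval X f1 f2 x \<alpha>))"

definition fuzzy_differentiable :: "(real \<Rightarrow> fuzzy) \<Rightarrow> (fuzzy \<Rightarrow> fuzzy) \<Rightarrow> real \<Rightarrow> bool" where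
  "fuzzy_differentiable X F x \<longleftrightarrow> (\<exists>D. has_fuzzy_deriv X F x D)"

definition fuzzy_deriv :: "(real \<Rightarrow> fuzzy) \<Rightarrow> (fuzzy \<Rightarrow> fuzzy) \<Rightarrow> real \<Rightarrow> fuzzy" where
  "fuzzy_deriv X F x = (THE D. has_fuzzy_deriv X F x D)"

section \<open>Well-definedness\<close>

lemma is_fuzzy_number_membership: "is_fuzzy_number (membership a)"
  using membership by simp

lemma fuzzy_eqI:
  assumes "\<And>\<alpha>. \<alpha> \<in> {0..1} \<Longrightarrow> level a \<alpha> = level b \<alpha>"
  shows "a = b"
proof -
  have *: "membership d t \<le> membership c t"
    if "\<And>\<alpha>. \<alpha> \<in> {0..1} \<Longrightarrow> level c \<alpha> = level d \<alpha>" for c d t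
  proof (cases "membership d t = 0")
    case True
    then show ?thesis
      using is_fuzzy_number_membership[of c] by (simp add: is_fuzzy_number_def)
  next
    case False
    moreover have "membership d t \<in> {0..1}"
      using is_fuzzy_number_membership[of d] by (simp add: is_fuzzy_number_def)
    ultimately show ?thesis
      using that[of "membership d t"] by (auto simp: level_def)
  qed
  have "membership a = membership b"
    using assms by (intro ext antisym *) auto
  then show ?thesis
    by (simp add: membership_inject)
qed

lemma level_eq_interval:
  assumes "\<alpha> \<in> {0..1}"
  shows "level a \<alpha> = {lower a \<alpha>..upper a \<alpha>}" and "lower a \<alpha> \<le> upper a \<alpha>"
proof -
  let ?m = "membership a"
  note m = is_fuzzy_number_membership[of a, unfolded is_fuzzy_number_def]
  have quasi: "min (?m r) (?m t) \<le> ?m (u * r + v * t)" if "0 \<le> u" "0 \<le> v" "u + v = 1" for r t u v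
  proof -
    have "v = 1 - u" "u \<le> 1" using that by auto
    with m \<open>0 \<le> u\<close> show ?thesis by metis
  qed
  have conv: "convex {r. \<alpha> \<le> ?m r}" "convex {r. 0 < ?m r}" for \<alpha>
  proof -
    show "convex {r. \<alpha> \<le> ?m r}"
      by (rule convexI) (auto intro!: order_trans[OF _ quasi])
    show "convex {r. 0 < ?m r}"
      by (rule convexI) (auto intro!: less_le_trans[OF _ quasi])
  qed
  obtain r0 where r0: "?m r0 = 1" using m by blast
  have cl: "closed {r. \<alpha> \<le> ?m r}" for \<alpha>
  proof -
    have "open {r. ?m r < \<alpha>}"
    proof (subst open_subopen, clarify)
      fix r assume "?m r < \<alpha>"
      then have "\<forall>\<^sub>F t in nhds r. ?m t < \<alpha>"
        using m unfolding usc_def by blast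
      then show "\<exists>T. open T \<and> r \<in> T \<and> T \<subseteq> {r. ?m r < \<alpha>}"
        unfolding eventually_nhds by blast
    qed
    moreover have "- {r. ?m r < \<alpha>} = {r. \<alpha> \<le> ?m r}" by auto
    ultimately show ?thesis by (metis closed_Compl)
  qed
  have "r0 \<in> level a \<alpha>"
    using r0 assms closure_subset[of "{r. 0 < ?m r}"] by (auto simp: level_def)
  moreover have "convex (level a \<alpha>)"
    using conv by (auto simp: level_def convex_closure)
  moreover have "compact (level a \<alpha>)"
  proof (cases "\<alpha> = 0")
    case True
    then show ?thesis using m by (simp add: level_def)
  next
    case False
    then have "{r. \<alpha> \<le> ?m r} \<subseteq> closure {r. 0 < ?m r}"
      using assms closure_subset[of "{r. 0 < ?m r}"] by force
    then have "compact ({r. \<alpha> \<le> ?m r} \<inter> closure {r. 0 < ?m r})"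
      using m cl closed_Int_compact by blast
    with False \<open>{r. \<alpha> \<le> ?m r} \<subseteq> _\<close> show ?thesis
      by (simp add: level_def Int_absorb2)
  qed
  ultimately obtain p q where "level a \<alpha> = {p..q}" "p \<le> q"
    using connected_compact_interval_1[of "level a \<alpha>"] convex_connected by fastforce
  then show "level a \<alpha> = {lower a \<alpha>..upper a \<alpha>}" and "lower a \<alpha> \<le> upper a \<alpha>"
    by (auto simp: lower_def upper_def)
qed

lemma scaled_Collect:
  assumes "k \<noteq> 0"
  shows "{r. P (r / k)} = (*) k ` {r::real. P r}"
proof (intro equalityI subsetI)
  fix r assume "r \<in> {r. P (r / k)}"
  then have "r / k \<in> {r. P r}" and "r = k * (r / k)" using assms by auto
  then show "r \<in> (*) k ` {r. P r}" by blast
qed (use assms in auto)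

lemma is_fuzzy_number_rescale:
  assumes "is_fuzzy_number a" and "k \<noteq> 0"
  shows "is_fuzzy_number (\<lambda>t. a (t / k))"
proof -
  note m = assms(1)[unfolded is_fuzzy_number_def]
  obtain r0 where "a r0 = 1" using m by blast
  then have "a ((k * r0) / k) = 1" using assms by simp
  moreover have "min (a (r / k)) (a (t / k)) \<le> a ((\<beta> * r + (1 - \<beta>) * t) / k)"
    if "0 \<le> \<beta>" "\<beta> \<le> 1" for r t \<beta>
  proof -
    have "(\<beta> * r + (1 - \<beta>) * t) / k = \<beta> * (r / k) + (1 - \<beta>) * (t / k)"
      by (simp add: add_divide_distrib)
    with m that show ?thesis by metis
  qed
  moreover have "usc (\<lambda>t. a (t / k))"
    unfolding usc_def
  proof clarify
    fix r c assume "a (r / k) < c"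
    then have "\<forall>\<^sub>F t in nhds (r / k). a t < c"
      using m unfolding usc_def by blast
    moreover have "filterlim (\<lambda>t. t / k) (nhds (r / k)) (nhds r)"
      using assms by (intro tendsto_intros filterlim_ident) auto
    ultimately show "\<forall>\<^sub>F t in nhds r. a (t / k) < c"
      by (rule eventually_compose_filterlim)
  qed
  moreover have "compact (closure {r. 0 < a (r / k)})"
  proof -
    have "{r. 0 < a (r / k)} = (*) k ` {r. 0 < a r}"
      by (rule scaled_Collect[OF assms(2)])
    then have "closure {r. 0 < a (r / k)} = (*) k ` closure {r. 0 < a r}"
      using closure_scaleR[of k "{r. 0 < a r}"] by simp
    then show ?thesis
      using m compact_scaling[of "closure {r. 0 < a r}" k] by simp
  qed
  ultimately show ?thesis
    using m unfolding is_fuzzy_number_def by blast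
qed

lemma level_fuzzy_scale:
  assumes "\<alpha> \<in> {0..1}"
  shows "level (k \<odot> a) \<alpha> =
    (if 0 \<le> k then {k * lower a \<alpha>..k * upper a \<alpha>} else {k * upper a \<alpha>..k * lower a \<alpha>})"
proof -
  define J where "J \<alpha> =
    (if 0 \<le> k then {k * lower a \<alpha>..k * upper a \<alpha>} else {k * upper a \<alpha>..k * lower a \<alpha>})" for \<alpha>
  have "\<exists>b. \<forall>\<alpha>\<in>{0..1}. level b \<alpha> = J \<alpha>"
  proof (cases "k = 0")
    case True
    have "{r. 0 < (indicator {0} r :: real)} = {0::real}"
      by (auto simp: indicator_def)
    then have "\<forall>\<alpha>\<in>{0..1}. level (Abs_fuzzy (indicator {0})) \<alpha> = J \<alpha>"
      using True is_fuzzy_number_zero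
      by (auto simp: level_def J_def Abs_fuzzy_inverse indicator_def split: if_splits)
    then show ?thesis by blast
  next
    case False
    define b where "b = Abs_fuzzy (\<lambda>t. membership a (t / k))"
    have mb: "membership b = (\<lambda>t. membership a (t / k))"
      using is_fuzzy_number_rescale[OF is_fuzzy_number_membership False]
      by (simp add: b_def Abs_fuzzy_inverse)
    have img: "{r. P (r / k)} = (*) k ` {r. P r}" for P
      by (rule scaled_Collect[OF False])
    have "level b \<alpha> = J \<alpha>" if "\<alpha> \<in> {0..1}" for \<alpha>
    proof -
      have "level b \<alpha> = (*) k ` level a \<alpha>"
        using img[of "\<lambda>r. 0 < membership a r"] img[of "\<lambda>r. \<alpha> \<le> membership a r"]
          closure_scaleR[of k "{r. 0 < membership a r}"]
        by (simp add: level_def mb)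
      also have "\<dots> = J \<alpha>"
        using level_eq_interval[OF that, of a] False by (auto simp: J_def image_mult_atLeastAtMost_if)
      finally show ?thesis .
    qed
    then show ?thesis by blast
  qed
  then have "\<exists>!b. \<forall>\<alpha>\<in>{0..1}. level b \<alpha> = J \<alpha>"
    by (auto intro: fuzzy_eqI)
  from theI'[OF this] show ?thesis
    using assms unfolding fuzzy_scale_def J_def by blast
qed

lemma level_functions_eq:
  assumes "level_functions X F f1 f2" and "\<alpha> \<in> {0..1}"
  shows "f1 (lower (X x) \<alpha>) (upper (X x) \<alpha>) \<alpha> = lower (F (X x)) \<alpha>"
    and "f2 (lower (X x) \<alpha>) (upper (X x) \<alpha>) \<alpha> = upper (F (X x)) \<alpha>"
proof -
  have "{f1 (lower (X x) \<alpha>) (upper (X x) \<alpha>) \<alpha>..f2 (lower (X x) \<alpha>) (upper (X x) \<alpha>) \<alpha>} =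
      {lower (F (X x)) \<alpha>..upper (F (X x)) \<alpha>}"
    using assms level_eq_interval(1)[OF assms(2), of "F (X x)"]
    unfolding level_functions_def by metis
  with level_eq_interval(2)[OF assms(2), of "F (X x)"]
  show "f1 (lower (X x) \<alpha>) (upper (X x) \<alpha>) \<alpha> = lower (F (X x)) \<alpha>"
    and "f2 (lower (X x) \<alpha>) (upper (X x) \<alpha>) \<alpha> = upper (F (X x)) \<alpha>"
    unfolding Icc_eq_Icc by linarith+
qed

lemma level_deriv_chain:
  assumes "(\<lambda>y. lower (X y) \<alpha>) differentiable (at x)" "(\<lambda>y. upper (X y) \<alpha>) differentiable (at x)"
    and "(\<lambda>(u, v). f u v \<alpha>) differentiable (at (lower (X x) \<alpha>, upper (X x) \<alpha>))"
  shows "((\<lambda>y. f (lower (X y) \<alpha>) (upper (X y) \<alpha>) \<alpha>) has_real_derivative level_deriv X f x \<alpha>) (at x)"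
proof -
  let ?p = "lower (X x) \<alpha>" and ?q = "upper (X x) \<alpha>"
  obtain A where A: "((\<lambda>(u, v). f u v \<alpha>) has_derivative A) (at (?p, ?q))"
    using assms(3) unfolding differentiable_def by blast
  interpret A: bounded_linear A by (rule has_derivative_bounded_linear[OF A])
  obtain d1 where d1: "((\<lambda>y. lower (X y) \<alpha>) has_real_derivative d1) (at x)"
    using assms(1) real_differentiable_def by blast
  obtain d2 where d2: "((\<lambda>y. upper (X y) \<alpha>) has_real_derivative d2) (at x)"
    using assms(2) real_differentiable_def by blast
  have d1': "((\<lambda>y. lower (X y) \<alpha>) has_derivative (\<lambda>h. h * d1)) (at x)"
    using has_field_derivative_imp_has_derivative[OF d1] by (simp add: mult_commute_abs)
  have d2': "((\<lambda>y. upper (X y) \<alpha>) has_derivative (\<lambda>h. h * d2)) (at x)"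
    using has_field_derivative_imp_has_derivative[OF d2] by (simp add: mult_commute_abs)
  have scale: "A (h * c, h * d) = h * A (c, d)" for h c d
    using A.scaleR[of h "(c, d)"] by simp
  have A10: "(\<lambda>h. A (h, 0)) = (*) (A (1, 0))"
    by (rule ext) (metis scale[of _ 1 0] mult.commute mult.right_neutral mult_zero_right)
  have A01: "(\<lambda>h. A (0, h)) = (*) (A (0, 1))"
    by (rule ext) (metis scale[of _ 0 1] mult.commute mult.right_neutral mult_zero_right)
  have "((\<lambda>u. (\<lambda>(u, v). f u v \<alpha>) (u, ?q)) has_derivative (\<lambda>h. A (h, 0))) (at ?p)"
    by (rule has_derivative_compose[where f="\<lambda>u. (u, ?q)" and f'="\<lambda>h. (h, 0)" and g'=A, OF _ A])
      (intro has_derivative_Pair has_derivative_ident has_derivative_const)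
  then have p1: "deriv (\<lambda>u. f u ?q \<alpha>) ?p = A (1, 0)"
    by (intro DERIV_imp_deriv) (simp add: has_field_derivative_def A10)
  have "((\<lambda>v. (\<lambda>(u, v). f u v \<alpha>) (?p, v)) has_derivative (\<lambda>h. A (0, h))) (at ?q)"
    by (rule has_derivative_compose[where f="\<lambda>v. (?p, v)" and f'="\<lambda>h. (0, h)" and g'=A, OF _ A])
      (intro has_derivative_Pair has_derivative_ident has_derivative_const)
  then have p2: "deriv (\<lambda>v. f ?p v \<alpha>) ?q = A (0, 1)"
    by (intro DERIV_imp_deriv) (simp add: has_field_derivative_def A01)
  have "((\<lambda>y. (\<lambda>(u, v). f u v \<alpha>) (lower (X y) \<alpha>, upper (X y) \<alpha>)) has_derivative
      (\<lambda>h. A (h * d1, h * d2))) (at x)"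
    by (rule has_derivative_compose[where f="\<lambda>y. (lower (X y) \<alpha>, upper (X y) \<alpha>)"
          and f'="\<lambda>h. (h * d1, h * d2)" and g'=A, OF _ A])
      (intro has_derivative_Pair d1' d2')
  moreover have "A (h * d1, h * d2) = level_deriv X f x \<alpha> * h" for h
  proof -
    have "A (d1, d2) = A (d1 * 1, d1 * 0) + A (d2 * 0, d2 * 1)"
      by (subst A.add[symmetric]) simp
    also have "\<dots> = A (1, 0) * d1 + A (0, 1) * d2"
      unfolding scale by simp
    finally show ?thesis
      unfolding scale level_deriv_def p1 p2 DERIV_imp_deriv[OF d1] DERIV_imp_deriv[OF d2]
      by simp
  qed
  ultimately show ?thesis
    by (simp add: has_field_derivative_def)
qed

lemma has_fuzzy_deriv_unique:
  assumes "has_fuzzy_deriv X F x D" and "has_fuzzy_deriv X F x D'"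
  shows "D = D'"
proof -
  have *: "level E \<alpha> =
      {min (deriv (\<lambda>y. lower (F (X y)) \<alpha>) x) (deriv (\<lambda>y. upper (F (X y)) \<alpha>) x)..
       max (deriv (\<lambda>y. lower (F (X y)) \<alpha>) x) (deriv (\<lambda>y. upper (F (X y)) \<alpha>) x)}"
    if E: "has_fuzzy_deriv X F x E" and \<alpha>: "\<alpha> \<in> {0..1}" for E \<alpha>
  proof -
    obtain f1 f2 where f: "level_functions X F f1 f2"
      and d: "(\<lambda>y. lower (X y) \<alpha>) differentiable (at x)" "(\<lambda>y. upper (X y) \<alpha>) differentiable (at x)"
        "(\<lambda>(u, v). f1 u v \<alpha>) differentiable (at (lower (X x) \<alpha>, upper (X x) \<alpha>))"
        "(\<lambda>(u, v). f2 u v \<alpha>) differentiable (at (lower (X x) \<alpha>, upper (X x) \<alpha>))"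
      and lev: "level E \<alpha> = deriv_interval X f1 f2 x \<alpha>"
      using E \<alpha> unfolding has_fuzzy_deriv_def by blast
    from level_deriv_chain[of X \<alpha> x f1, OF d(1,2,3)] level_deriv_chain[of X \<alpha> x f2, OF d(1,2,4)]
    show ?thesis
      unfolding level_functions_eq[OF f \<alpha>] lev deriv_interval_def
      by (simp add: DERIV_imp_deriv)
  qed
  show ?thesis
    by (rule fuzzy_eqI) (simp add: *[OF assms(1)] *[OF assms(2)])
qed

end

theory Submission
  imports Defs
begin

text \<open>
  The level functions of \<open>k \<odot> F\<close> are \<open>k f\<^sub>1\<close>, \<open>k f\<^sub>2\<close> for \<open>k \<ge> 0\<close>; for \<open>k < 0\<close> the factor reverses
  the intervals and they are \<open>k f\<^sub>2\<close>, \<open>k f\<^sub>1\<close>. Differentiation along the fuzzification is linear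
  (\<open>level_deriv_cmult\<close>), so \<open>f\<^sub>1'\<close> and \<open>f\<^sub>2'\<close> are multiplied by \<open>k\<close> and possibly swapped. The
  interval between the two derivatives does not depend on their order, and multiplication by \<open>k\<close>
  maps it to the interval between the multiplied values; these are the level sets of
  \<open>k \<odot> F'\<close> (\<open>level_fuzzy_scale_minmax\<close>). A fuzzy number is the union of its level sets
  (\<open>fuzzy_union_level\<close>), hence \<open>k \<odot> F'\<close> is also the union of the new intervals. Since derivatives
  are unique, nothing else can be the derivative of \<open>k \<odot> F\<close>.
\<close>

text \<open>The supremum at \<open>t\<close> is attained at \<open>\<alpha> = membership a t\<close>. The level \<open>\<alpha> = 0\<close>, where the level
  set is a closure and may contain points of membership \<open>0\<close>, contributes only the value \<open>0\<close>.\<close>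

lemma fuzzy_union_level: "fuzzy_union (level a) = membership a"
proof
  fix t
  let ?m = "membership a t"
  have m: "?m \<in> {0..1}"
    using is_fuzzy_number_membership[of a] by (simp add: is_fuzzy_number_def)
  show "fuzzy_union (level a) t = ?m"
    unfolding fuzzy_union_def
  proof (rule cSup_eq_maximum)
    have "?m = ?m * indicator (level a ?m) t"
      by (auto simp: level_def indicator_def)
    with m show "?m \<in> (\<lambda>\<alpha>. \<alpha> * indicator (level a \<alpha>) t) ` {0..1}"
      by blast
  next
    fix s
    assume "s \<in> (\<lambda>\<alpha>. \<alpha> * indicator (level a \<alpha>) t) ` {0..1}"
    with m show "s \<le> ?m"
      by (auto simp: level_def indicator_def split: if_splits)
  qed
qed

lemma fuzzy_union_cong:
  assumes "\<And>\<alpha>. \<alpha> \<in> {0..1} \<Longrightarrow> I \<alpha> = J \<alpha>"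
  shows "fuzzy_union I = fuzzy_union J"
  unfolding fuzzy_union_def
  by (intro ext arg_cong[where f = Sup] image_cong refl) (simp add: assms)

text \<open>Writing the interval with \<open>min\<close> and \<open>max\<close> absorbs the sign of \<open>k\<close>.\<close>

lemma level_fuzzy_scale_minmax:
  assumes "\<alpha> \<in> {0..1}" and "level a \<alpha> = {min p q..max p q}"
  shows "level (k \<odot> a) \<alpha> = {min (k * p) (k * q)..max (k * p) (k * q)}"
proof -
  have "lower a \<alpha> = min p q" "upper a \<alpha> = max p q"
    using assms(2) by (simp_all add: lower_def upper_def)
  then show ?thesis
    using level_fuzzy_scale[OF assms(1), of k a]
    by (simp add: min_mult_distrib_left max_mult_distrib_left min.commute max.commute)
qed

lemma level_functions_fuzzy_scale:
  assumes "level_functions X F f1 f2"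
  shows "level_functions X (\<lambda>y. k \<odot> F y)
    (\<lambda>u v \<alpha>. k * (if 0 \<le> k then f1 else f2) u v \<alpha>)
    (\<lambda>u v \<alpha>. k * (if 0 \<le> k then f2 else f1) u v \<alpha>)"
  unfolding level_functions_def
  by (simp add: level_fuzzy_scale level_functions_eq[OF assms])

lemma differentiable_cmult_case_prod:
  fixes f :: "real \<Rightarrow> real \<Rightarrow> real"
  assumes "(\<lambda>(u, v). f u v) differentiable (at z)"
  shows "(\<lambda>(u, v). k * f u v) differentiable (at z)"
  using differentiable_mult[OF differentiable_const assms, of k]
  by (simp add: case_prod_unfold)

text \<open>By the chain rule both sides are derivatives at \<open>x\<close> of the same real function
  \<open>y \<mapsto> k f(x\<^sub>1(y,\<alpha>), x\<^sub>2(y,\<alpha>), \<alpha>)\<close>.\<close>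

lemma level_deriv_cmult:
  assumes "(\<lambda>y. lower (X y) \<alpha>) differentiable (at x)" "(\<lambda>y. upper (X y) \<alpha>) differentiable (at x)"
    and "(\<lambda>(u, v). f u v \<alpha>) differentiable (at (lower (X x) \<alpha>, upper (X x) \<alpha>))"
  shows "level_deriv X (\<lambda>u v \<alpha>. k * f u v \<alpha>) x \<alpha> = k * level_deriv X f x \<alpha>"
proof (rule DERIV_unique)
  show "((\<lambda>y. k * f (lower (X y) \<alpha>) (upper (X y) \<alpha>) \<alpha>) has_real_derivative
      level_deriv X (\<lambda>u v \<alpha>. k * f u v \<alpha>) x \<alpha>) (at x)"
    using assms(1,2) differentiable_cmult_case_prod[OF assms(3)]
    by (rule level_deriv_chain[where f = "\<lambda>u v \<alpha>. k * f u v \<alpha>"])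
  show "((\<lambda>y. k * f (lower (X y) \<alpha>) (upper (X y) \<alpha>) \<alpha>) has_real_derivative
      k * level_deriv X f x \<alpha>) (at x)"
    by (rule DERIV_cmult[OF level_deriv_chain[of X \<alpha> x f, OF assms]])
qed

lemma has_fuzzy_deriv_fuzzy_scale:
  assumes "has_fuzzy_deriv X F x D"
  shows "has_fuzzy_deriv X (\<lambda>y. k \<odot> F y) x (k \<odot> D)"
proof -
  obtain f1 f2 where f: "level_functions X F f1 f2"
    and X: "\<And>\<alpha>. \<alpha> \<in> {0..1} \<Longrightarrow> (\<lambda>y. lower (X y) \<alpha>) differentiable (at x)"
      "\<And>\<alpha>. \<alpha> \<in> {0..1} \<Longrightarrow> (\<lambda>y. upper (X y) \<alpha>) differentiable (at x)"
    and d: "\<And>\<alpha>. \<alpha> \<in> {0..1} \<Longrightarrow>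
        (\<lambda>(u, v). f1 u v \<alpha>) differentiable (at (lower (X x) \<alpha>, upper (X x) \<alpha>))"
      "\<And>\<alpha>. \<alpha> \<in> {0..1} \<Longrightarrow>
        (\<lambda>(u, v). f2 u v \<alpha>) differentiable (at (lower (X x) \<alpha>, upper (X x) \<alpha>))"
    and lev: "\<And>\<alpha>. \<alpha> \<in> {0..1} \<Longrightarrow> level D \<alpha> = deriv_interval X f1 f2 x \<alpha>"
    using assms unfolding has_fuzzy_deriv_def by blast
  define g1 where "g1 = (if 0 \<le> k then f1 else f2)"
  define g2 where "g2 = (if 0 \<le> k then f2 else f1)"
  let ?h1 = "\<lambda>u v \<alpha>. k * g1 u v \<alpha>" and ?h2 = "\<lambda>u v \<alpha>. k * g2 u v \<alpha>"
  have dg: "(\<lambda>(u, v). g1 u v \<alpha>) differentiable (at (lower (X x) \<alpha>, upper (X x) \<alpha>))"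
      "(\<lambda>(u, v). g2 u v \<alpha>) differentiable (at (lower (X x) \<alpha>, upper (X x) \<alpha>))"
    if "\<alpha> \<in> {0..1}" for \<alpha>
    using d[OF that] by (simp_all add: g1_def g2_def)
  have dh: "(\<lambda>(u, v). ?h1 u v \<alpha>) differentiable (at (lower (X x) \<alpha>, upper (X x) \<alpha>))"
      "(\<lambda>(u, v). ?h2 u v \<alpha>) differentiable (at (lower (X x) \<alpha>, upper (X x) \<alpha>))"
    if "\<alpha> \<in> {0..1}" for \<alpha>
    by (rule differentiable_cmult_case_prod, rule dg[OF that])+
  have levk: "level (k \<odot> D) \<alpha> = deriv_interval X ?h1 ?h2 x \<alpha>" if \<alpha>: "\<alpha> \<in> {0..1}" for \<alpha>
  proof -
    have "level D \<alpha> = deriv_interval X g1 g2 x \<alpha>"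
      using lev[OF \<alpha>] by (simp add: deriv_interval_def g1_def g2_def min.commute max.commute)
    then show ?thesis
      unfolding deriv_interval_def level_deriv_cmult[of X \<alpha> x g1, OF X[OF \<alpha>] dg(1)[OF \<alpha>]]
        level_deriv_cmult[of X \<alpha> x g2, OF X[OF \<alpha>] dg(2)[OF \<alpha>]]
      by (rule level_fuzzy_scale_minmax[OF \<alpha>])
  qed
  have "membership (k \<odot> D) = fuzzy_union (deriv_interval X ?h1 ?h2 x)"
    unfolding fuzzy_union_level[symmetric] by (rule fuzzy_union_cong) (rule levk)
  moreover have "level_functions X (\<lambda>y. k \<odot> F y) ?h1 ?h2"
    unfolding g1_def g2_def by (rule level_functions_fuzzy_scale[OF f])
  ultimately show ?thesis
    unfolding has_fuzzy_deriv_def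
    by (intro exI[of _ ?h1] exI[of _ ?h2] conjI ballI X dh levk)
qed

lemma fuzzy_deriv_eqI:
  assumes "has_fuzzy_deriv X F x D"
  shows "fuzzy_deriv X F x = D"
  unfolding fuzzy_deriv_def
  by (rule the_equality) (use assms has_fuzzy_deriv_unique in blast)+

theorem theorem3p3:
  fixes X :: "real \<Rightarrow> fuzzy" and F :: "fuzzy \<Rightarrow> fuzzy" and x k :: real
  assumes "fuzzification X"
    and "fuzzy_differentiable X F x"
  shows "fuzzy_differentiable X (\<lambda>y. k \<odot> F y) x \<and>
    fuzzy_deriv X (\<lambda>y. k \<odot> F y) x = k \<odot> fuzzy_deriv X F x"
proof -
  obtain D where D: "has_fuzzy_deriv X F x D"
    using assms(2) unfolding fuzzy_differentiable_def by blast
  note kD = has_fuzzy_deriv_fuzzy_scale[OF D, of k]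
  have "fuzzy_differentiable X (\<lambda>y. k \<odot> F y) x"
    unfolding fuzzy_differentiable_def using kD by (rule exI)
  then show ?thesis
    unfolding fuzzy_deriv_eqI[OF D] fuzzy_deriv_eqI[OF kD] by simp
qed

end
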